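(* For every $k\ge 1$, the commutator subgroup $G_k'$ coincides with the set of all commutators of $G_k$, i.e. $G_k'=\{[f_1,f_2] \mid f_1\in G_k,\ f_2\in G_k\}$.
   Context: $[a,b]=aba^{-1}b^{-1}$, and $G'=[G,G]$ is the derived subgroup. $C_2=\langle\sigma\rangle$ with $\sigma=(1,2)$. For a group $B$, elements of $B\wr C_2$ are written $(g_1,g_2)\pi$ with $g_1,g_2\in B$ and $\pi\in C_2$, with multiplication $(g_1,g_2)\pi_g\cdot(h_1,h_2)\pi_h=(g_1h_{\pi_g(1)},g_2h_{\pi_g(2)})\pi_g\pi_h$. Define recursively $B_1=C_2$ and $B_k=B_{k-1}\wr C_2$ for $k>1$. Define $G_1=\{e\}$ and $G_k=\{(g_1,g_2)\pi\in B_k \mid g_1g_2\in G_{k-1}\}$ for $k>1$. ($B_k$ is isomorphic to a Sylow 2-subgroup of $S_{2^k}$ and $G_k$ is isomorphic to a Sylow 2-subgroup of $A_{2^k}$.) *)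

theory Defs
  imports "HOL-Algebra.Sym_Groups"
begin

definition C2 :: "(nat \<Rightarrow> nat) monoid" where
  "C2 = (sym_group 2)\<lparr>carrier := generate (sym_group 2) {transpose 1 2}\<rparr>"

text \<open>
  The types of the iterated wreath products grow with \<open>k\<close>, so the elements of all of them are
  embedded in one datatype: \<open>Base \<pi>\<close> is the element \<open>\<pi>\<close> of \<open>C2\<close>, and \<open>Wr g\<^sub>1 g\<^sub>2 \<pi>\<close> is
  \<open>(g\<^sub>1, g\<^sub>2)\<pi>\<close>. The multiplications below only matter on operands of the same shape.
\<close>

datatype wr_elt = Base "nat \<Rightarrow> nat" | Wr wr_elt wr_elt "nat \<Rightarrow> nat"

fun base_mult :: "wr_elt \<Rightarrow> wr_elt \<Rightarrow> wr_elt" where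
  "base_mult (Base p) (Base q) = Base (p \<otimes>\<^bsub>C2\<^esub> q)"

definition base_C2 :: "wr_elt monoid" where
  "base_C2 = \<lparr>carrier = Base ` carrier C2, mult = base_mult, one = Base \<one>\<^bsub>C2\<^esub>\<rparr>"

definition coord :: "wr_elt \<Rightarrow> wr_elt \<Rightarrow> nat \<Rightarrow> wr_elt" where
  "coord h1 h2 i = (if i = 1 then h1 else h2)"

fun wr_mult :: "wr_elt monoid \<Rightarrow> wr_elt \<Rightarrow> wr_elt \<Rightarrow> wr_elt" where
  "wr_mult H (Wr g1 g2 p) (Wr h1 h2 q) =
     Wr (g1 \<otimes>\<^bsub>H\<^esub> coord h1 h2 (p 1)) (g2 \<otimes>\<^bsub>H\<^esub> coord h1 h2 (p 2)) (p \<otimes>\<^bsub>C2\<^esub> q)"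

definition wreath_C2 :: "wr_elt monoid \<Rightarrow> wr_elt monoid" where
  "wreath_C2 H =
     \<lparr>carrier = {Wr g1 g2 p | g1 g2 p. g1 \<in> carrier H \<and> g2 \<in> carrier H \<and> p \<in> carrier C2},
      mult = wr_mult H,
      one = Wr \<one>\<^bsub>H\<^esub> \<one>\<^bsub>H\<^esub> \<one>\<^bsub>C2\<^esub>\<rparr>"

text \<open>Both sequences start at index 1; the value at 0 is left unspecified.\<close>

fun B_grp :: "nat \<Rightarrow> wr_elt monoid" where
  "B_grp (Suc 0) = base_C2"
| "B_grp (Suc (Suc k)) = wreath_C2 (B_grp (Suc k))"

fun G_set :: "nat \<Rightarrow> wr_elt set" where
  "G_set (Suc 0) = {\<one>\<^bsub>B_grp (Suc 0)\<^esub>}"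
| "G_set (Suc (Suc k)) =
     {Wr g1 g2 p | g1 g2 p. Wr g1 g2 p \<in> carrier (B_grp (Suc (Suc k))) \<and>
        g1 \<otimes>\<^bsub>B_grp (Suc k)\<^esub> g2 \<in> G_set (Suc k)}"

definition G_grp :: "nat \<Rightarrow> wr_elt monoid" where
  "G_grp k = (B_grp k)\<lparr>carrier := G_set k\<rparr>"

definition commutator :: "('a, 'b) monoid_scheme \<Rightarrow> 'a \<Rightarrow> 'a \<Rightarrow> 'a" where
  "commutator G a b = a \<otimes>\<^bsub>G\<^esub> b \<otimes>\<^bsub>G\<^esub> inv\<^bsub>G\<^esub> a \<otimes>\<^bsub>G\<^esub> inv\<^bsub>G\<^esub> b"


lemma transpose_permutes_2: "transpose 1 2 permutes {1..2::nat}"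
  by (rule permutes_swap_id) auto

lemma mult_C2 [simp]: "p \<otimes>\<^bsub>C2\<^esub> q = p \<circ> q"
  by (simp add: C2_def sym_group_def)

lemma one_C2 [simp]: "\<one>\<^bsub>C2\<^esub> = id"
  by (simp add: C2_def sym_group_def)

lemma carrier_C2: "carrier C2 = {id, transpose 1 2}"
proof -
  interpret S: group "sym_group 2" by (rule sym_group_is_group)
  let ?s = "transpose 1 2 :: nat \<Rightarrow> nat"
  have s: "?s \<in> carrier (sym_group 2)"
    using transpose_permutes_2 by (simp add: sym_group_carrier)
  have inv_s: "inv\<^bsub>sym_group 2\<^esub> ?s = ?s"
    by (rule S.inv_equality) (use s in \<open>auto simp: sym_group_mult sym_group_one\<close>)
  have "x \<in> {id, ?s}" if "x \<in> generate (sym_group 2) {?s}" for x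
    using that by induction (auto simp: sym_group_mult sym_group_one inv_s[simplified])
  moreover have "{id, ?s} \<subseteq> generate (sym_group 2) {?s}"
    using generate.one[of "sym_group 2" "{?s}"] generate.incl[of ?s "{?s}" "sym_group 2"]
    by (simp add: sym_group_one)
  ultimately show ?thesis by (auto simp: C2_def)
qed

lemma base_C2_group: "group base_C2"
  by (rule groupI) (auto simp: base_C2_def carrier_C2)

lemma wreath_C2_group:
  assumes "group H"
  shows "group (wreath_C2 H)"
proof -
  interpret H: group H by fact
  show ?thesis
  proof (rule groupI)
    fix x assume "x \<in> carrier (wreath_C2 H)"
    then obtain g1 g2 p where x: "x = Wr g1 g2 p" "g1 \<in> carrier H" "g2 \<in> carrier H"
      "p \<in> carrier C2" by (auto simp: wreath_C2_def)
    show "\<exists>y\<in>carrier (wreath_C2 H). y \<otimes>\<^bsub>wreath_C2 H\<^esub> x = \<one>\<^bsub>wreath_C2 H\<^esub>"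
      by (rule bexI[of _ "Wr (inv\<^bsub>H\<^esub> (coord g1 g2 (p 1))) (inv\<^bsub>H\<^esub> (coord g1 g2 (p 2))) p"])
        (use x in \<open>auto simp: wreath_C2_def carrier_C2 coord_def\<close>)
  qed (auto simp: wreath_C2_def carrier_C2 coord_def H.m_assoc)
qed

lemma B_grp_group: "k \<ge> 1 \<Longrightarrow> group (B_grp k)"
  by (induction k rule: B_grp.induct) (auto simp: base_C2_group wreath_C2_group)

text \<open>\<open>G_set k\<close> is the kernel of a homomorphism from \<open>B_grp k\<close> onto a group of order 2.\<close>

primrec wr_odd :: "wr_elt \<Rightarrow> bool" where
  "wr_odd (Base p) = (p \<noteq> id)"
| "wr_odd (Wr g h p) = (wr_odd g \<noteq> wr_odd h)"

lemma transpose_neq_id: "transpose 1 2 \<noteq> (id :: nat \<Rightarrow> nat)"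
  by (metis id_apply numeral_One one_eq_numeral_iff semiring_norm(85) transpose_apply_first)

lemma wr_odd_mult:
  "\<lbrakk>k \<ge> 1; x \<in> carrier (B_grp k); y \<in> carrier (B_grp k)\<rbrakk>
    \<Longrightarrow> wr_odd (x \<otimes>\<^bsub>B_grp k\<^esub> y) = (wr_odd x \<noteq> wr_odd y)"
proof (induction k arbitrary: x y rule: B_grp.induct)
  case 1
  then show ?case using transpose_neq_id by (auto simp: base_C2_def carrier_C2)
next
  case (2 k)
  then show ?case by (auto simp: wreath_C2_def carrier_C2 coord_def)
qed auto

lemma G_set_eq: "k \<ge> 1 \<Longrightarrow> G_set k = {x \<in> carrier (B_grp k). \<not> wr_odd x}"
proof (induction k rule: B_grp.induct)
  case 1
  then show ?case using transpose_neq_id by (auto simp: base_C2_def carrier_C2)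
next
  case (2 k)
  interpret group "B_grp (Suc k)" by (rule B_grp_group) simp
  have IH: "x \<in> G_set (Suc k) \<longleftrightarrow> x \<in> carrier (B_grp (Suc k)) \<and> \<not> wr_odd x" for x
    using 2 by simp
  show ?case
  proof (rule Set.set_eqI)
    fix x
    show "x \<in> G_set (Suc (Suc k)) \<longleftrightarrow> x \<in> {x \<in> carrier (B_grp (Suc (Suc k))). \<not> wr_odd x}"
      by (cases x) (auto simp: IH wreath_C2_def wr_odd_mult simp del: G_set.simps(1) B_grp.simps(1))
  qed
qed auto

lemma G_set_subgroup:
  assumes "k \<ge> 1"
  shows "subgroup (G_set k) (B_grp k)"
proof -
  interpret group "B_grp k" using assms by (rule B_grp_group)
  have odd_one: "\<not> wr_odd \<one>\<^bsub>B_grp k\<^esub>"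
    using wr_odd_mult[OF assms one_closed one_closed] by simp
  have "wr_odd (inv\<^bsub>B_grp k\<^esub> x) = wr_odd x" if "x \<in> carrier (B_grp k)" for x
    using wr_odd_mult[OF assms inv_closed[OF that] that] that odd_one by simp
  then show ?thesis
    by (intro subgroupI) (use odd_one in \<open>auto simp: G_set_eq[OF assms] wr_odd_mult[OF assms]\<close>)
qed

lemma G_grp_group: "k \<ge> 1 \<Longrightarrow> group (G_grp k)"
  unfolding G_grp_def by (rule subgroup.subgroup_is_group[OF G_set_subgroup B_grp_group])

end

theory Submission
  imports Defs
begin

text \<open>
  Both \<open>B_grp k\<close> and \<open>G_grp k\<close> carry enough homomorphisms to a group of order 2 that every common
  kernel element is a single commutator. For \<open>B_grp k\<close> these are the parities of the \<open>k\<close> levels of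
  the tree; for \<open>G_grp k\<close> one needs in addition the parity \<open>wr_odd g\<close> of the first coordinate of
  \<open>(g, h)\<pi>\<close>, which is multiplicative because the two coordinates have equal parity. The commutators
  come from one identity: if \<open>g h = [u, v]\<close>, then
  \<open>(g, h) = [(1, g\<inverse> u g)\<sigma>, (g\<inverse> v g, v g)]\<close>. Inductively \<open>u\<close> can be taken even, and then the first
  operand is even; the second one is even as soon as \<open>g\<close> is.
\<close>

text \<open>Level 0 is the root. On \<open>B_grp k\<close> the value is \<open>False\<close> for
  every \<open>n \<ge> k\<close>, so one family indexed by \<open>nat\<close> serves all
  \<open>k\<close>.\<close>

primrec level_odd :: "wr_elt \<Rightarrow> nat \<Rightarrow> bool" where
  "level_odd (Base p) n = (n = 0 \<and> p \<noteq> id)"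
| "level_odd (Wr g h p) n = (case n of 0 \<Rightarrow> p \<noteq> id | Suc m \<Rightarrow> level_odd g m \<noteq> level_odd h m)"

primrec fst_odd :: "wr_elt \<Rightarrow> bool" where
  "fst_odd (Base p) = False"
| "fst_odd (Wr g h p) = wr_odd g"

text \<open>The permutation in \<open>x\<close> at most swaps the two subtrees of \<open>y\<close>,
  and a level parity is symmetric in them.\<close>

lemma level_odd_mult:
  "\<lbrakk>k \<ge> 1; x \<in> carrier (B_grp k); y \<in> carrier (B_grp k)\<rbrakk>
    \<Longrightarrow> level_odd (x \<otimes>\<^bsub>B_grp k\<^esub> y) n = (level_odd x n \<noteq> level_odd y n)"
proof (induction k arbitrary: x y n rule: B_grp.induct)
  case 1
  then show ?case using transpose_neq_id by (auto simp: base_C2_def carrier_C2)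
next
  case (2 k)
  then show ?case using transpose_neq_id
    by (auto simp: wreath_C2_def carrier_C2 coord_def split: nat.splits)
qed auto

lemma carrier_G_grp: "carrier (G_grp k) = G_set k"
  and mult_G_grp: "x \<otimes>\<^bsub>G_grp k\<^esub> y = x \<otimes>\<^bsub>B_grp k\<^esub> y"
  by (simp_all add: G_grp_def)

text \<open>A swap in \<open>x\<close> puts the second coordinate of \<open>y\<close> in place of
  the first; inside \<open>G_set\<close> both have the same \<open>wr_odd\<close>.\<close>

lemma fst_odd_mult:
  assumes "x \<in> G_set (Suc (Suc k))" "y \<in> G_set (Suc (Suc k))"
  shows "fst_odd (x \<otimes>\<^bsub>B_grp (Suc (Suc k))\<^esub> y) = (fst_odd x \<noteq> fst_odd y)"
  using assms
  by (auto simp: G_set_eq wreath_C2_def carrier_C2 coord_def wr_odd_mult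
      simp del: G_set.simps B_grp.simps(1))

text \<open>Stating \<open>[a, b] = x\<close> as \<open>a b = x b a\<close> avoids computing
  inverses in a wreath product.\<close>

lemma (in group) commutator_eqI:
  assumes "a \<in> carrier G" "b \<in> carrier G" "x \<in> carrier G" "a \<otimes> b = x \<otimes> b \<otimes> a"
  shows "commutator G a b = x"
  using assms by (simp add: commutator_def m_assoc)

text \<open>Each \<open>\<chi> i\<close> is a homomorphism to Z/2, with \<open>\<noteq>\<close> as
  addition. Their common kernel is a subgroup containing all commutators, hence the derived
  subgroup, and \<open>ker\<close> makes each of its elements a commutator.\<close>

lemma (in group) derived_eq_commutators:
  fixes \<chi> :: "'i \<Rightarrow> 'a \<Rightarrow> bool"
  assumes hom: "\<And>i x y. \<lbrakk>x \<in> carrier G; y \<in> carrier G\<rbrakk> \<Longrightarrow> \<chi> i (x \<otimes> y) = (\<chi> i x \<noteq> \<chi> i y)"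
    and ker: "\<And>x. \<lbrakk>x \<in> carrier G; \<And>i. \<not> \<chi> i x\<rbrakk>
      \<Longrightarrow> \<exists>a\<in>carrier G. \<exists>b\<in>carrier G. a \<otimes> b = x \<otimes> b \<otimes> a"
  shows "derived G (carrier G) =
    {commutator G a b | a b. a \<in> carrier G \<and> b \<in> carrier G}" (is "_ = ?C")
proof
  let ?K = "{x \<in> carrier G. \<forall>i. \<not> \<chi> i x}"
  have hom_one: "\<not> \<chi> i \<one>" for i
    using hom[OF one_closed one_closed] by simp
  have hom_inv: "\<chi> i (inv x) = \<chi> i x" if "x \<in> carrier G" for i x
    using hom[OF inv_closed[OF that] that, of i] hom_one[of i] that by simp
  have "subgroup ?K G"
    by (intro subgroupI) (use hom_one in \<open>auto simp: hom hom_inv\<close>)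
  moreover have "(\<Union>a\<in>carrier G. \<Union>b\<in>carrier G. {a \<otimes> b \<otimes> inv a \<otimes> inv b}) \<subseteq> ?K"
    by (auto simp: hom hom_inv)
  ultimately have "derived G (carrier G) \<subseteq> ?K"
    unfolding derived_def by (intro generate_subgroup_incl)
  also have "?K \<subseteq> ?C"
  proof
    fix x assume x: "x \<in> ?K"
    then obtain a b where ab: "a \<in> carrier G" "b \<in> carrier G" "a \<otimes> b = x \<otimes> b \<otimes> a"
      using ker[of x] by auto
    then have "commutator G a b = x"
      using x by (intro commutator_eqI) auto
    with ab show "x \<in> ?C" by blast
  qed
  finally show "derived G (carrier G) \<subseteq> ?C" .
  show "?C \<subseteq> derived G (carrier G)"
    unfolding derived_def commutator_def by (auto intro: generate.incl)
qed

text \<open>Put \<open>a = (1, w)\<sigma>\<close> and \<open>b = (c, d)\<close>. The first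
  coordinate of the equation forces \<open>d = g c\<close>, and the second then says
  \<open>h g = [w, c]\<close>. As \<open>h g\<close> is \<open>g h\<close> conjugated by
  \<open>g\<close>, conjugating \<open>u\<close> and \<open>v\<close> likewise gives
  \<open>w\<close> and \<open>c\<close>.\<close>

lemma wreath_C2_commutator:
  fixes H (structure)
  assumes "group H"
    and "g \<in> carrier H" "h \<in> carrier H" "u \<in> carrier H" "v \<in> carrier H"
    and uv: "u \<otimes> v = g \<otimes> h \<otimes> v \<otimes> u"
  defines "a \<equiv> Wr \<one> (inv g \<otimes> u \<otimes> g) (transpose 1 2)"
    and "b \<equiv> Wr (inv g \<otimes> v \<otimes> g) (v \<otimes> g) id"
  shows "a \<in> carrier (wreath_C2 H)" "b \<in> carrier (wreath_C2 H)"
    and "a \<otimes>\<^bsub>wreath_C2 H\<^esub> b = Wr g h id \<otimes>\<^bsub>wreath_C2 H\<^esub> b \<otimes>\<^bsub>wreath_C2 H\<^esub> a"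
proof -
  interpret group H by fact
  show "a \<in> carrier (wreath_C2 H)" "b \<in> carrier (wreath_C2 H)"
    using assms(2-5) by (auto simp: a_def b_def wreath_C2_def carrier_C2)
  have cancel: "g \<otimes> (inv g \<otimes> x) = x" "inv g \<otimes> (g \<otimes> x) = x" if "x \<in> carrier H" for x
    using that assms(2) by (simp_all flip: m_assoc)
  have "inv g \<otimes> (u \<otimes> v) \<otimes> g = inv g \<otimes> (g \<otimes> h \<otimes> v \<otimes> u) \<otimes> g"
    by (simp only: uv)
  then have "inv g \<otimes> (u \<otimes> (v \<otimes> g)) = h \<otimes> (v \<otimes> (u \<otimes> g))"
    using assms(2-5) by (simp add: m_assoc cancel)
  then show "a \<otimes>\<^bsub>wreath_C2 H\<^esub> b = Wr g h id \<otimes>\<^bsub>wreath_C2 H\<^esub> b \<otimes>\<^bsub>wreath_C2 H\<^esub> a"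
    using assms(2-5) by (simp add: a_def b_def wreath_C2_def coord_def m_assoc cancel)
qed

lemma wr_odd_one: "k \<ge> 1 \<Longrightarrow> \<not> wr_odd \<one>\<^bsub>B_grp k\<^esub>"
  using subgroup.one_closed[OF G_set_subgroup] by (auto simp: G_set_eq)

lemma wr_odd_inv:
  assumes "k \<ge> 1" "g \<in> carrier (B_grp k)"
  shows "wr_odd (inv\<^bsub>B_grp k\<^esub> g) = wr_odd g"
proof -
  interpret group "B_grp k" using assms(1) by (rule B_grp_group)
  show ?thesis
    using wr_odd_mult[OF assms(1) inv_closed[OF assms(2)] assms(2)] wr_odd_one[OF assms(1)] assms(2)
    by simp
qed

text \<open>Taking \<open>u\<close> from \<open>G_set k\<close> strengthens the induction claim: it
  is what makes the first operand even one level up.\<close>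

lemma B_grp_commutator:
  assumes "k \<ge> 1" "x \<in> carrier (B_grp k)" "\<And>n. \<not> level_odd x n"
  shows "\<exists>u\<in>G_set k. \<exists>v\<in>carrier (B_grp k). u \<otimes>\<^bsub>B_grp k\<^esub> v = x \<otimes>\<^bsub>B_grp k\<^esub> v \<otimes>\<^bsub>B_grp k\<^esub> u"
  using assms
proof (induction k arbitrary: x rule: B_grp.induct)
  case 1
  from 1(2) 1(3)[of 0] have "x = Base id" using transpose_neq_id by (auto simp: base_C2_def carrier_C2)
  then show ?case by (auto simp: base_C2_def carrier_C2)
next
  case (2 k)
  let ?H = "B_grp (Suc k)"
  interpret H: group ?H by (rule B_grp_group) simp
  obtain g h p where x: "x = Wr g h p" and gh: "g \<in> carrier ?H" "h \<in> carrier ?H"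
    using "2.prems" by (auto simp: wreath_C2_def)
  have p: "p = id" using "2.prems"(3)[of 0] by (simp add: x)
  \<comment> \<open>Level \<open>n\<close> of \<open>g h\<close> is level \<open>Suc n\<close> of
    \<open>(g, h)\<close>.\<close>
  have "\<not> level_odd (g \<otimes>\<^bsub>?H\<^esub> h) n" for n
    using "2.prems"(3)[of "Suc n"] gh by (simp add: x level_odd_mult del: B_grp.simps)
  then obtain u v where uv: "u \<in> G_set (Suc k)" "v \<in> carrier ?H"
    "u \<otimes>\<^bsub>?H\<^esub> v = g \<otimes>\<^bsub>?H\<^esub> h \<otimes>\<^bsub>?H\<^esub> v \<otimes>\<^bsub>?H\<^esub> u"
    using "2.IH"[of "g \<otimes>\<^bsub>?H\<^esub> h"] gh by auto
  have u: "u \<in> carrier ?H" "\<not> wr_odd u" using uv(1) by (auto simp: G_set_eq)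
  note ab = wreath_C2_commutator[OF H.is_group gh u(1) uv(2,3)]
  \<comment> \<open>Conjugation preserves parity, so this element has the parity of
    \<open>u\<close>.\<close>
  have "Wr \<one>\<^bsub>?H\<^esub> (inv\<^bsub>?H\<^esub> g \<otimes>\<^bsub>?H\<^esub> u \<otimes>\<^bsub>?H\<^esub> g) (transpose 1 2) \<in> G_set (Suc (Suc k))"
    using ab(1) u gh by (simp add: G_set_eq wr_odd_mult wr_odd_inv wr_odd_one
        del: G_set.simps)
  with ab show ?case unfolding x p B_grp.simps by blast
qed auto

text \<open>No induction here: \<open>u\<close> and \<open>v\<close> come from the result for
  \<open>B_grp\<close>, so \<open>v\<close> may be odd.\<close>

lemma G_grp_commutator:
  assumes "x \<in> G_set (Suc (Suc k))" "\<And>n. \<not> level_odd x n" "\<not> fst_odd x"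
  shows "\<exists>a\<in>G_set (Suc (Suc k)). \<exists>b\<in>G_set (Suc (Suc k)).
    a \<otimes>\<^bsub>B_grp (Suc (Suc k))\<^esub> b = x \<otimes>\<^bsub>B_grp (Suc (Suc k))\<^esub> b \<otimes>\<^bsub>B_grp (Suc (Suc k))\<^esub> a"
proof -
  let ?H = "B_grp (Suc k)"
  interpret H: group ?H by (rule B_grp_group) simp
  obtain g h p where x: "x = Wr g h p" and gh: "g \<in> carrier ?H" "h \<in> carrier ?H"
    using assms by (auto simp: wreath_C2_def)
  have p: "p = id" using assms(2)[of 0] by (simp add: x)
  have g: "\<not> wr_odd g" using assms(3) by (simp add: x)
  have "\<not> level_odd (g \<otimes>\<^bsub>?H\<^esub> h) n" for n
    using assms(2)[of "Suc n"] gh by (simp add: x level_odd_mult del: B_grp.simps)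
  then obtain u v where uv: "u \<in> G_set (Suc k)" "v \<in> carrier ?H"
    "u \<otimes>\<^bsub>?H\<^esub> v = g \<otimes>\<^bsub>?H\<^esub> h \<otimes>\<^bsub>?H\<^esub> v \<otimes>\<^bsub>?H\<^esub> u"
    using B_grp_commutator[of "Suc k" "g \<otimes>\<^bsub>?H\<^esub> h"] gh by auto
  have u: "u \<in> carrier ?H" "\<not> wr_odd u" using uv(1) by (auto simp: G_set_eq)
  note ab = wreath_C2_commutator[OF H.is_group gh u(1) uv(2,3)]
  have "Wr \<one>\<^bsub>?H\<^esub> (inv\<^bsub>?H\<^esub> g \<otimes>\<^bsub>?H\<^esub> u \<otimes>\<^bsub>?H\<^esub> g) (transpose 1 2) \<in> G_set (Suc (Suc k))"
    using ab(1) u gh by (simp add: G_set_eq wr_odd_mult wr_odd_inv wr_odd_one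
        del: G_set.simps)
  \<comment> \<open>The coordinates have the parities of \<open>v\<close> and of \<open>v g\<close>;
    that of \<open>v\<close> cancels, leaving that of \<open>g\<close>, which is even.\<close>
  moreover have "Wr (inv\<^bsub>?H\<^esub> g \<otimes>\<^bsub>?H\<^esub> v \<otimes>\<^bsub>?H\<^esub> g) (v \<otimes>\<^bsub>?H\<^esub> g) id \<in> G_set (Suc (Suc k))"
    using ab(2) uv(2) gh g by (simp add: G_set_eq wr_odd_mult wr_odd_inv del: G_set.simps)
  ultimately show ?thesis using ab(3) unfolding x p B_grp.simps by blast
qed

theorem theorem19:
  fixes k :: nat
  assumes "k \<ge> 1"
  shows "derived (G_grp k) (carrier (G_grp k)) =
    {commutator (G_grp k) f1 f2 | f1 f2. f1 \<in> carrier (G_grp k) \<and> f2 \<in> carrier (G_grp k)}"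
proof (cases k rule: B_grp.cases)
  case 1
  interpret group "G_grp k" using assms by (rule G_grp_group)
  show ?thesis
    \<comment> \<open>The group is trivial, so the zero homomorphism suffices.\<close>
    by (rule derived_eq_commutators[where \<chi> = "\<lambda>_ _. False"])
      (use 1 in \<open>auto simp: carrier_G_grp mult_G_grp base_C2_def\<close>)
next
  case k: (2 m)
  interpret group "G_grp k" using assms by (rule G_grp_group)
  show ?thesis
  \<comment> \<open>Index 0 carries \<open>fst_odd\<close>, index \<open>Suc n\<close> the parity of
    level \<open>n\<close>.\<close>
  proof (rule derived_eq_commutators
      [where \<chi> = "case_nat fst_odd (\<lambda>n x. level_odd x n)"])
    fix i x y
    assume xy: "x \<in> carrier (G_grp k)" "y \<in> carrier (G_grp k)"
    then have "x \<in> carrier (B_grp k)" "y \<in> carrier (B_grp k)"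
      using assms by (auto simp: carrier_G_grp G_set_eq)
    then show "case_nat fst_odd (\<lambda>n x. level_odd x n) i (x \<otimes>\<^bsub>G_grp k\<^esub> y) =
        (case_nat fst_odd (\<lambda>n x. level_odd x n) i x \<noteq> case_nat fst_odd (\<lambda>n x. level_odd x n) i y)"
      using xy fst_odd_mult[of x m y] level_odd_mult[OF assms, of x y]
      by (cases i) (simp_all add: mult_G_grp carrier_G_grp k del: G_set.simps B_grp.simps)
  next
    fix x
    assume "x \<in> carrier (G_grp k)"
      and "\<And>i. \<not> case_nat fst_odd (\<lambda>n x. level_odd x n) i x"
    from this(1) this(2)[of 0] this(2)[of "Suc n" for n]
    have "x \<in> G_set (Suc (Suc m))" "\<And>n. \<not> level_odd x n" "\<not> fst_odd x"
      by (simp_all add: carrier_G_grp k del: G_set.simps)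
    then show "\<exists>a\<in>carrier (G_grp k). \<exists>b\<in>carrier (G_grp k).
        a \<otimes>\<^bsub>G_grp k\<^esub> b = x \<otimes>\<^bsub>G_grp k\<^esub> b \<otimes>\<^bsub>G_grp k\<^esub> a"
      unfolding mult_G_grp carrier_G_grp k by (rule G_grp_commutator)
  qed
qed (use assms in simp)

end
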